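(* Let $\alpha\in(0,1)$. For $x\in(0,1)$ let $h(z)=h_x(z)=\ln z-x\ln\bigl(1-(1-z)^{\alpha}\bigr)$, $z\in(0,1)$, let $z(x)$ be the unique root of $h_x'(z)=0$ in $(0,1)$, and let $I(x)=h_x(z(x))$. Then for $x\in(0,1)$ $$I'(x)=-\ln\bigl(1-(1-z(x))^{\alpha}\bigr),\qquad I''(x)=-\frac{\alpha(1-z(x))^{\alpha-1}}{1-(1-z(x))^{\alpha}}\,z'(x),$$ and, as $x\to0^+$, $$1-z(x)=\alpha^{\frac{1}{1-\alpha}}x^{\frac{1}{1-\alpha}}\left[1+O\bigl(x^{\frac{\alpha}{1-\alpha}}\bigr)\right],\qquad I''(x)\sim\frac{\alpha^{\frac{1}{1-\alpha}}}{1-\alpha}\,x^{\frac{2\alpha-1}{1-\alpha}},$$ $$h''(z(x))=-\frac{1-\alpha}{\alpha^{\frac{1}{1-\alpha}}}\,\frac{1}{x^{\frac{1}{1-\alpha}}}\left[1+O\bigl(x^{\frac{\alpha}{1-\alpha}}\bigr)\right].$$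
   Context: Here $h''(z(x))$ is the second derivative of $h_x(z)$ with respect to $z$ with $x$ fixed, evaluated at $z=z(x)$; $I'$, $I''$ and $z'$ are derivatives with respect to $x$. As $x\to0^+$, $f(x)=g(x)[1+O(c(x))]$ means $|f(x)/g(x)-1|\le M c(x)$ for all sufficiently small $x>0$ with $M$ independent of $x$, and $f\sim g$ means $f/g\to1$. *)

theory Defs
  imports "HOL-Analysis.Analysis" "HOL-Library.Landau_Symbols"
begin

definition h :: "real \<Rightarrow> real \<Rightarrow> real \<Rightarrow> real" where
  "h \<alpha> x z = ln z - x * ln (1 - (1 - z) powr \<alpha>)"

(* The description is well defined for 0 < alpha < 1 and 0 < x < 1; see ex1_critical_point below. *)
definition z_crit :: "real \<Rightarrow> real \<Rightarrow> real" where
  "z_crit \<alpha> x = (THE z. z \<in> {0<..<1} \<and> deriv (h \<alpha> x) z = 0)"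

definition I_crit :: "real \<Rightarrow> real \<Rightarrow> real" where
  "I_crit \<alpha> x = h \<alpha> x (z_crit \<alpha> x)"

lemma one_minus_powr_pos:
  fixes \<alpha> z :: real
  assumes "0 < \<alpha>" "z \<in> {0<..<1}"
  shows "1 - (1 - z) powr \<alpha> > 0"
  using powr_less_mono2[of \<alpha> "1 - z" 1] assms by simp

lemma h_has_real_derivative:
  fixes \<alpha> x z :: real
  assumes "0 < \<alpha>" "z \<in> {0<..<1}"
  shows "(h \<alpha> x has_real_derivative
           1 / z - x * (\<alpha> * (1 - z) powr (\<alpha> - 1)) / (1 - (1 - z) powr \<alpha>)) (at z)"
proof -
  have "((\<lambda>z. ln z - x * ln (1 - (1 - z) powr \<alpha>)) has_real_derivative
           1 / z - x * (\<alpha> * (1 - z) powr (\<alpha> - 1)) / (1 - (1 - z) powr \<alpha>)) (at z)"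
    using assms one_minus_powr_pos[OF assms]
    by (auto intro!: derivative_eq_intros simp: powr_diff field_simps)
  moreover have "h \<alpha> x = (\<lambda>z. ln z - x * ln (1 - (1 - z) powr \<alpha>))"
    by (simp add: h_def fun_eq_iff)
  ultimately show ?thesis by simp
qed

lemma deriv_h_eq_0_iff:
  fixes \<alpha> x z :: real
  assumes "0 < \<alpha>" "z \<in> {0<..<1}"
  shows "deriv (h \<alpha> x) z = 0 \<longleftrightarrow>
           (1 - z) powr (1 - \<alpha>) - (1 - z) + x * \<alpha> * (1 - z) - x * \<alpha> = 0"
proof -
  define w where "w = 1 - z"
  have w: "0 < w" "w < 1" "z = 1 - w" using assms by (auto simp: w_def)
  have p: "1 - w powr \<alpha> > 0" using one_minus_powr_pos[OF assms] by (simp add: w_def)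
  have q: "w powr \<alpha> > 0" using w by simp
  have "deriv (h \<alpha> x) z = 1 / z - x * (\<alpha> * w powr (\<alpha> - 1)) / (1 - w powr \<alpha>)"
    unfolding w_def by (rule DERIV_imp_deriv[OF h_has_real_derivative[OF assms]])
  also have "\<dots> = 1 / (1 - w) - x * \<alpha> * w powr \<alpha> / (w * (1 - w powr \<alpha>))"
    using w by (simp add: powr_diff)
  also have "\<dots> = 0 \<longleftrightarrow> w * (1 - w powr \<alpha>) = x * \<alpha> * w powr \<alpha> * (1 - w)"
    using w p by (simp add: divide_simps) (auto simp: algebra_simps)
  also have "\<dots> \<longleftrightarrow> (w / w powr \<alpha>) - w = x * \<alpha> * (1 - w)"
    using q by (simp add: field_simps)
  also have "w / w powr \<alpha> = w powr (1 - \<alpha>)"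
    using w by (simp add: powr_diff)
  finally show ?thesis by (simp add: w_def algebra_simps)
qed

lemma ex1_critical_point:
  fixes \<alpha> x :: real
  assumes a: "0 < \<alpha>" "\<alpha> < 1" and x: "0 < x" "x < 1"
  shows "\<exists>!z. z \<in> {0<..<1} \<and> deriv (h \<alpha> x) z = 0"
proof -
  define p where "p w = w powr (1 - \<alpha>) - w + x * \<alpha> * w - x * \<alpha>" for w :: real
  define p' where "p' w = (1 - \<alpha>) * w powr (- \<alpha>) - 1 + x * \<alpha>" for w :: real
  have der: "(p has_real_derivative p' w) (at w)" if "w > 0" for w
    unfolding p_def[abs_def] p'_def
    by (rule derivative_eq_intros has_real_derivative_powr[OF that] refl | simp)+
  have dec: "p' v > p' w" if "0 < v" "v < w" for v w
    using that a by (simp add: p'_def powr_less_mono2_neg)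
  have p0: "p 0 < 0" and p1: "p 1 = 0" using a x by (auto simp: p_def)
  have cont: "continuous_on {0..b} p" for b
    unfolding p_def[abs_def] using a by (auto intro!: continuous_intros continuous_on_powr')
  have p'1: "p' 1 < 0" using a x by (simp add: p'_def)
  obtain d where d: "d > 0" "\<And>e. 0 < e \<Longrightarrow> e < d \<Longrightarrow> p 1 < p (1 - e)"
    using DERIV_neg_dec_left[OF der p'1] by auto
  define b where "b = 1 - min (d / 2) (1 / 2)"
  have b: "0 < b" "b < 1" "p b > 0"
    using d(1) d(2)[of "min (d / 2) (1 / 2)"] p1 by (auto simp: b_def min_def)
  obtain w where w: "0 \<le> w" "w \<le> b" "p w = 0"
    using IVT'[of p 0 0 b] p0 b cont by auto
  have w01: "0 < w" "w < 1" using w p0 b by (auto simp: order.order_iff_strict)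
  have no: False if uv: "0 < u" "u < v" "v < 1" "p u = 0" "p v = 0" for u v
  proof -
    have rolle: "\<exists>c>s. c < t \<and> p' c = 0" if "0 < s" "s < t" "p s = p t" for s t
    proof -
      have "\<exists>c>s. c < t \<and> (p has_real_derivative 0) (at c)"
      proof (rule Rolle)
        show "continuous_on {s..t} p"
          by (rule continuous_on_subset[OF cont[of t]]) (use that in auto)
        show "p differentiable (at c)" if "s < c" "c < t" for c
          using der[of c] \<open>0 < s\<close> that real_differentiable_def by (meson less_trans)
      qed (use that in auto)
      then obtain c where c: "s < c" "c < t" "(p has_real_derivative 0) (at c)" by blast
      then have "p' c = 0" using DERIV_unique[OF der c(3)] that by simp
      then show ?thesis using c by blast
    qed
    obtain c1 where c1: "u < c1" "c1 < v" "p' c1 = 0"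
      using rolle[of u v] uv by auto
    obtain c2 where c2: "v < c2" "c2 < 1" "p' c2 = 0"
      using rolle[of v 1] uv p1 by auto
    show False using dec[of c1 c2] c1 c2 that by auto
  qed
  have iff: "deriv (h \<alpha> x) z = 0 \<longleftrightarrow> p (1 - z) = 0" if "z \<in> {0<..<1}" for z
    unfolding p_def by (rule deriv_h_eq_0_iff[OF a(1) that])
  show ?thesis
  proof (rule ex1I[of _ "1 - w"])
    show "1 - w \<in> {0<..<1} \<and> deriv (h \<alpha> x) (1 - w) = 0"
      using w01 w iff[of "1 - w"] by auto
  next
    fix z assume z: "z \<in> {0<..<1} \<and> deriv (h \<alpha> x) z = 0"
    then have "p (1 - z) = 0" using iff by blast
    then show "z = 1 - w"
      using no[of w "1 - z"] no[of "1 - z" w] z w01 w(3)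
      by (cases w "1 - z" rule: linorder_cases) auto
  qed
qed

end

theory Submission
  imports Defs "HOL-Real_Asymp.Real_Asymp"
begin

text \<open>
  With \<open>w = 1 - z\<close>, the critical equation \<open>h' = 0\<close> is linear in \<open>x\<close>: it says
  \<open>\<alpha> x = w powr (1 - \<alpha>) * s(w)\<close>, where \<open>s(w) = (1 - w powr \<alpha>) / (1 - w)\<close> is the slope of the chord of
  \<open>t \<mapsto> t powr \<alpha>\<close> over \<open>[w, 1]\<close>. So \<open>w(x) = 1 - z(x)\<close> has an explicit inverse \<open>X\<close> (called
  \<open>crit_param\<close> below), and everything is computed from \<open>X\<close>.

  Strict concavity of the power gives \<open>s(w) > \<alpha>\<close> (lemma \<open>chord_slope_greater\<close>), and this one
  inequality has two main uses. First, \<open>X'(w)\<close> is a positive multiple of \<open>s(w) - \<alpha>\<close>, so \<open>z\<close> is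
  differentiable with \<open>z'(x) = - 1 / X'(w(x))\<close>. The formula for \<open>I'\<close> is then the envelope identity: the
  term \<open>h'(z(x)) z'(x)\<close> of the chain rule vanishes; differentiating once more gives \<open>I''\<close>.
  Second, \<open>s(w) > \<alpha>\<close> turns the critical equation into \<open>w(x) < x powr (1 / (1 - \<alpha>))\<close>, so that
  \<open>w(x) \<rightarrow> 0\<close> and \<open>w(x) powr \<alpha>\<close> is bounded by the error term \<open>x powr (\<alpha> / (1 - \<alpha>))\<close>.

  For the asymptotics, each quotient in question is, after substituting \<open>x = X(w)\<close>, an explicit function
  of \<open>w\<close> alone, built from \<open>s(w) = 1 + O(w powr \<alpha>)\<close>. For example
  \<open>w / (\<alpha> x) powr (1 / (1 - \<alpha>)) = s(w) powr (- 1 / (1 - \<alpha>))\<close>. It then remains to expand at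
  \<open>w = 0\<close> and to compose with \<open>w(x)\<close>.
\<close>

section \<open>The inverse of the critical point\<close>

definition chord_slope :: "real \<Rightarrow> real \<Rightarrow> real" where
  "chord_slope \<alpha> w = (1 - w powr \<alpha>) / (1 - w)"

text \<open>
  The slope of the chord over \<open>[w, 1]\<close> is the derivative at some point of \<open>(w, 1)\<close>; the derivative of
  the power is strictly decreasing and equals \<open>\<alpha>\<close> at \<open>1\<close>.
\<close>

lemma chord_slope_greater:
  assumes "0 < \<alpha>" "\<alpha> < 1" "0 < w" "w < 1"
  shows "\<alpha> < chord_slope \<alpha> w"
proof -
  have "\<exists>c. w < c \<and> c < 1 \<and> 1 powr \<alpha> - w powr \<alpha> = (1 - w) * (\<alpha> * c powr (\<alpha> - 1))"
    by (rule MVT2) (use assms in \<open>auto intro!: derivative_eq_intros simp: powr_diff\<close>)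
  then obtain c where c: "w < c" "c < 1" "1 - w powr \<alpha> = (1 - w) * (\<alpha> * c powr (\<alpha> - 1))"
    by auto
  have "c powr (\<alpha> - 1) > 1 powr (\<alpha> - 1)"
    using c assms by (intro powr_less_mono2_neg) auto
  then show ?thesis using c assms by (simp add: chord_slope_def)
qed

text \<open>
  The parameter \<open>x\<close> for which \<open>1 - w\<close> is a critical point of \<open>h \<alpha> x\<close>.
\<close>

definition crit_param :: "real \<Rightarrow> real \<Rightarrow> real" where
  "crit_param \<alpha> w = w powr (1 - \<alpha>) * chord_slope \<alpha> w / \<alpha>"

definition crit_param_deriv :: "real \<Rightarrow> real \<Rightarrow> real" where
  "crit_param_deriv \<alpha> w = w powr (- \<alpha>) * (chord_slope \<alpha> w - \<alpha>) / (\<alpha> * (1 - w))"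

lemma crit_param_eq:
  assumes "0 < w"
  shows "crit_param \<alpha> w = (w powr (1 - \<alpha>) - w) / (\<alpha> * (1 - w))"
proof -
  have "w powr (1 - \<alpha>) * (1 - w powr \<alpha>) = w powr (1 - \<alpha>) - w"
    using assms by (simp add: right_diff_distrib powr_add[symmetric])
  then show ?thesis by (simp add: crit_param_def chord_slope_def mult.commute)
qed

lemma deriv_h_eq_0_iff_crit_param:
  assumes "0 < \<alpha>" "z \<in> {0<..<1}"
  shows "deriv (h \<alpha> x) z = 0 \<longleftrightarrow> crit_param \<alpha> (1 - z) = x"
  using assms unfolding deriv_h_eq_0_iff[OF assms] by (auto simp: crit_param_eq field_simps)

lemma z_crit_root:
  assumes "0 < \<alpha>" "\<alpha> < 1" "0 < x" "x < 1"
  shows "z_crit \<alpha> x \<in> {0<..<1}" "deriv (h \<alpha> x) (z_crit \<alpha> x) = 0"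
  using theI'[OF ex1_critical_point[OF assms]] unfolding z_crit_def by auto

lemma crit_param_z_crit:
  assumes "0 < \<alpha>" "\<alpha> < 1" "0 < x" "x < 1"
  shows "crit_param \<alpha> (1 - z_crit \<alpha> x) = x"
  using z_crit_root[OF assms] deriv_h_eq_0_iff_crit_param assms by blast

text \<open>
  Since \<open>z_crit\<close> is meaningful only for parameters in \<open>(0, 1)\<close>, the range conditions on
  \<open>crit_param \<alpha> w\<close> are hypotheses. Below they are met by continuity, close to a point where they hold.
\<close>

lemma z_crit_crit_param:
  assumes "0 < \<alpha>" "\<alpha> < 1" "0 < w" "w < 1" "0 < crit_param \<alpha> w" "crit_param \<alpha> w < 1"
  shows "z_crit \<alpha> (crit_param \<alpha> w) = 1 - w"
proof -
  have "deriv (h \<alpha> (crit_param \<alpha> w)) (1 - w) = 0"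
    using deriv_h_eq_0_iff_crit_param[of \<alpha> "1 - w"] assms by simp
  then show ?thesis
    unfolding z_crit_def using assms
    by (intro the1_equality ex1_critical_point) auto
qed

lemma has_real_derivative_crit_param:
  assumes "0 < \<alpha>" "0 < w" "w < 1"
  shows "(crit_param \<alpha> has_real_derivative crit_param_deriv \<alpha> w) (at w)"
proof -
  have "((\<lambda>w. w powr (1 - \<alpha>)) has_real_derivative (1 - \<alpha>) * w powr (- \<alpha>)) (at w)"
    using has_real_derivative_powr[OF assms(2), of "1 - \<alpha>"] by simp
  then have "((\<lambda>w. (w powr (1 - \<alpha>) - w) / (\<alpha> * (1 - w))) has_real_derivative
      (((1 - \<alpha>) * w powr (- \<alpha>) - 1) * (\<alpha> * (1 - w)) - (w powr (1 - \<alpha>) - w) * - \<alpha>)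
        / (\<alpha> * (1 - w) * (\<alpha> * (1 - w)))) (at w)"
    using assms by (auto intro!: derivative_eq_intros)
  also have "(((1 - \<alpha>) * w powr (- \<alpha>) - 1) * (\<alpha> * (1 - w)) - (w powr (1 - \<alpha>) - w) * - \<alpha>)
        / (\<alpha> * (1 - w) * (\<alpha> * (1 - w))) = crit_param_deriv \<alpha> w"
    using assms
    by (simp add: crit_param_deriv_def chord_slope_def powr_diff powr_minus divide_simps)
       (simp add: algebra_simps)
  finally have d: "((\<lambda>w. (w powr (1 - \<alpha>) - w) / (\<alpha> * (1 - w))) has_real_derivative
      crit_param_deriv \<alpha> w) (at w)" .
  show ?thesis
    by (rule has_field_derivative_transform_within_open[OF d, where S = "{0<..}"])
       (use assms in \<open>auto simp: crit_param_eq\<close>)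
qed

lemma crit_param_deriv_pos:
  assumes "0 < \<alpha>" "\<alpha> < 1" "0 < w" "w < 1"
  shows "crit_param_deriv \<alpha> w > 0"
  using chord_slope_greater[OF assms] assms by (simp add: crit_param_deriv_def)

text \<open>
  The parameter map is continuous near \<open>w = 1 - z_crit \<alpha> x\<close> and is inverted there by
  \<open>1 - z_crit\<close>, so its inverse is continuous at \<open>x\<close>; this is the premise of the
  inverse function rule for derivatives.
\<close>

lemma isCont_z_crit:
  assumes "0 < \<alpha>" "\<alpha> < 1" "0 < x" "x < 1"
  shows "isCont (z_crit \<alpha>) x"
proof -
  define w where "w = 1 - z_crit \<alpha> x"
  have w: "0 < w" "w < 1" and cw: "crit_param \<alpha> w = x"
    using z_crit_root[OF assms] crit_param_z_crit[OF assms] by (auto simp: w_def)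
  have cont: "isCont (crit_param \<alpha>) v" if "0 < v" "v < 1" for v
    using DERIV_isCont[OF has_real_derivative_crit_param[OF assms(1) that]] .
  have "\<forall>\<^sub>F v in at w. crit_param \<alpha> v \<in> {0<..<1} \<and> v \<in> {0<..<1}"
  proof (rule eventually_conj)
    show "\<forall>\<^sub>F v in at w. crit_param \<alpha> v \<in> {0<..<1}"
      using cont[OF w] assms cw
      by (intro topological_tendstoD[of "crit_param \<alpha>" x]) (auto simp: isCont_def)
    show "\<forall>\<^sub>F v in at w. v \<in> {0<..<1}"
      using w by (intro eventually_at_in_open') auto
  qed
  then obtain d where d: "d > 0"
    "\<And>v. v \<noteq> w \<Longrightarrow> dist v w < d \<Longrightarrow> crit_param \<alpha> v \<in> {0<..<1} \<and> v \<in> {0<..<1}"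
    unfolding eventually_at by blast
  have near: "crit_param \<alpha> v \<in> {0<..<1} \<and> v \<in> {0<..<1}" if "\<bar>v - w\<bar> \<le> d / 2" for v
    using d that assms cw w by (cases "v = w") (auto simp: dist_real_def)
  have "isCont (\<lambda>y. 1 - z_crit \<alpha> y) (crit_param \<alpha> w)"
  proof (rule isCont_inverse_function[where f = "crit_param \<alpha>" and x = w])
    show "0 < d / 2" using d by simp
    show "1 - z_crit \<alpha> (crit_param \<alpha> v) = v" if "\<bar>v - w\<bar> \<le> d / 2" for v
      using near[OF that] z_crit_crit_param[OF assms(1,2)] by simp
    show "isCont (crit_param \<alpha>) v" if "\<bar>v - w\<bar> \<le> d / 2" for v
      using near[OF that] cont by simp
  qed
  then have "isCont (\<lambda>y. 1 - (1 - z_crit \<alpha> y)) x"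
    unfolding cw by (rule continuous_diff[OF continuous_const])
  then show ?thesis by simp
qed

lemma has_real_derivative_z_crit:
  assumes "0 < \<alpha>" "\<alpha> < 1" "0 < x" "x < 1"
  shows "(z_crit \<alpha> has_real_derivative - inverse (crit_param_deriv \<alpha> (1 - z_crit \<alpha> x))) (at x)"
proof -
  have z: "0 < z_crit \<alpha> x" "z_crit \<alpha> x < 1" using z_crit_root[OF assms] by auto
  have "((\<lambda>y. 1 - z_crit \<alpha> y) has_real_derivative
      inverse (crit_param_deriv \<alpha> (1 - z_crit \<alpha> x))) (at x)"
  proof (rule DERIV_inverse_function[of "crit_param \<alpha>" _ _ _ 0 1])
    show "(crit_param \<alpha> has_real_derivative crit_param_deriv \<alpha> (1 - z_crit \<alpha> x))
        (at (1 - z_crit \<alpha> x))"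
      using z assms by (intro has_real_derivative_crit_param) auto
    show "crit_param_deriv \<alpha> (1 - z_crit \<alpha> x) \<noteq> 0"
      using crit_param_deriv_pos[of \<alpha> "1 - z_crit \<alpha> x"] z assms by auto
    show "crit_param \<alpha> (1 - z_crit \<alpha> y) = y" if "0 < y" "y < 1" for y
      using crit_param_z_crit that assms by auto
    show "isCont (\<lambda>y. 1 - z_crit \<alpha> y) x"
      using isCont_z_crit[OF assms] by (intro continuous_intros)
  qed (use assms in auto)
  from DERIV_diff[OF DERIV_const[of 1] this] show ?thesis by simp
qed

lemma z_crit_differentiable:
  assumes "0 < \<alpha>" "\<alpha> < 1" "0 < x" "x < 1"
  shows "z_crit \<alpha> differentiable (at x)"
  using has_real_derivative_z_crit[OF assms] by (auto simp: real_differentiable_def)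

section \<open>Derivatives of the critical value\<close>

text \<open>
  The envelope identity: the dependence of \<open>I\<close> on \<open>x\<close> through the critical point contributes nothing to
  first order, because the \<open>z\<close>-derivative of \<open>h\<close> vanishes there.
\<close>

lemma has_real_derivative_I_crit:
  assumes "0 < \<alpha>" "\<alpha> < 1" "0 < x" "x < 1"
  shows "(I_crit \<alpha> has_real_derivative - ln (1 - (1 - z_crit \<alpha> x) powr \<alpha>)) (at x)"
proof -
  define z z' where "z = z_crit \<alpha> x" and "z' = deriv (z_crit \<alpha>) x"
  have z: "z \<in> {0<..<1}" and crit: "deriv (h \<alpha> x) z = 0"
    using z_crit_root[OF assms] by (auto simp: z_def)
  have dz: "(z_crit \<alpha> has_real_derivative z') (at x)"
    using has_real_derivative_z_crit[OF assms] DERIV_imp_deriv z'_def by metis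
  have p: "1 - (1 - z) powr \<alpha> > 0" using one_minus_powr_pos[OF assms(1) z] .
  have "1 / z - x * (\<alpha> * (1 - z) powr (\<alpha> - 1)) / (1 - (1 - z) powr \<alpha>) = 0"
    using crit DERIV_imp_deriv[OF h_has_real_derivative[OF assms(1) z]] by metis
  then have "(1 / z - x * (\<alpha> * (1 - z) powr (\<alpha> - 1)) / (1 - (1 - z) powr \<alpha>)) * z' = 0"
    by simp
  then have env: "z' / z - x * (\<alpha> * (1 - z) powr (\<alpha> - 1)) / (1 - (1 - z) powr \<alpha>) * z' = 0"
    by (simp add: left_diff_distrib)
  have "((\<lambda>y. ln (z_crit \<alpha> y) - y * ln (1 - (1 - z_crit \<alpha> y) powr \<alpha>)) has_real_derivative
      (z' / z - x * (\<alpha> * (1 - z) powr (\<alpha> - 1)) / (1 - (1 - z) powr \<alpha>) * z')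
        - ln (1 - (1 - z) powr \<alpha>)) (at x)"
    using z p by (auto intro!: derivative_eq_intros dz simp: z_def[symmetric] powr_diff field_simps)
  then show ?thesis
    unfolding env by (simp add: I_crit_def[abs_def] h_def z_def)
qed

lemma has_real_derivative_deriv_I_crit:
  assumes "0 < \<alpha>" "\<alpha> < 1" "0 < x" "x < 1"
  shows "(deriv (I_crit \<alpha>) has_real_derivative
      - (\<alpha> * (1 - z_crit \<alpha> x) powr (\<alpha> - 1) / (1 - (1 - z_crit \<alpha> x) powr \<alpha>))
        * deriv (z_crit \<alpha>) x) (at x)"
proof -
  define z z' where "z = z_crit \<alpha> x" and "z' = deriv (z_crit \<alpha>) x"
  have z: "z \<in> {0<..<1}" using z_crit_root[OF assms] by (auto simp: z_def)
  have dz: "(z_crit \<alpha> has_real_derivative z') (at x)"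
    using has_real_derivative_z_crit[OF assms] DERIV_imp_deriv z'_def by metis
  have p: "1 - (1 - z) powr \<alpha> > 0" using one_minus_powr_pos[OF assms(1) z] .
  have d: "((\<lambda>y. - ln (1 - (1 - z_crit \<alpha> y) powr \<alpha>)) has_real_derivative
      - (\<alpha> * (1 - z) powr (\<alpha> - 1) / (1 - (1 - z) powr \<alpha>)) * z') (at x)"
    using z p by (auto intro!: derivative_eq_intros dz simp: z_def[symmetric] powr_diff field_simps)
  show ?thesis
    unfolding z_def[symmetric] z'_def[symmetric]
  proof (rule has_field_derivative_transform_within_open[OF d, where S = "{0<..<1}"])
    show "- ln (1 - (1 - z_crit \<alpha> y) powr \<alpha>) = deriv (I_crit \<alpha>) y" if "y \<in> {0<..<1}" for y
      using DERIV_imp_deriv[OF has_real_derivative_I_crit, of \<alpha> y] that assms by simp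
  qed (use assms in auto)
qed

lemma deriv_deriv_h:
  assumes "0 < \<alpha>" "z \<in> {0<..<1}"
  shows "deriv (deriv (h \<alpha> x)) z =
    - (1 / z\<^sup>2) - x * \<alpha> * ((1 - \<alpha>) * (1 - z) powr (\<alpha> - 2) / (1 - (1 - z) powr \<alpha>)
        - \<alpha> * (1 - z) powr (2 * \<alpha> - 2) / (1 - (1 - z) powr \<alpha>)\<^sup>2)"
    (is "_ = ?d")
proof -
  have p: "1 - (1 - z) powr \<alpha> > 0" using one_minus_powr_pos[OF assms] .
  have e: "(1 - z) powr (2 * \<alpha> - 2) = ((1 - z) powr (\<alpha> - 1))\<^sup>2"
    "(1 - z) powr (\<alpha> - 2) = (1 - z) powr (\<alpha> - 1) / (1 - z)"
    using assms by (simp_all add: powr_diff power2_eq_square powr_add[symmetric] field_simps)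
  have d: "((\<lambda>z. 1 / z - x * (\<alpha> * (1 - z) powr (\<alpha> - 1)) / (1 - (1 - z) powr \<alpha>))
      has_real_derivative ?d) (at z)"
  proof -
    define A B where "A = (1 - z) powr (\<alpha> - 1)" and "B = 1 - (1 - z) powr \<alpha>"
    have dp: "((\<lambda>z. (1 - z) powr r) has_real_derivative - (r * (1 - z) powr (r - 1))) (at z)" for r
      using assms by (auto intro!: derivative_eq_intros simp: powr_diff)
    have dA: "((\<lambda>z. (1 - z) powr (\<alpha> - 1)) has_real_derivative (1 - \<alpha>) * A / (1 - z)) (at z)"
      using dp[of "\<alpha> - 1"] e(2) by (simp add: A_def minus_divide_left[symmetric] left_diff_distrib diff_divide_distrib)
    have dB: "((\<lambda>z. 1 - (1 - z) powr \<alpha>) has_real_derivative \<alpha> * A) (at z)"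
      using DERIV_diff[OF DERIV_const[of 1] dp[of \<alpha>]] by (simp add: A_def)
    have "((\<lambda>z. 1 / z - x * (\<alpha> * (1 - z) powr (\<alpha> - 1)) / (1 - (1 - z) powr \<alpha>)) has_real_derivative
        (0 * z - 1 * 1) / (z * z) - (x * (\<alpha> * ((1 - \<alpha>) * A / (1 - z))) * B - x * (\<alpha> * A) * (\<alpha> * A)) / (B * B))
        (at z)"
      unfolding A_def B_def using assms p
      by (intro DERIV_diff DERIV_divide DERIV_const DERIV_ident DERIV_cmult
          dA[unfolded A_def] dB[unfolded A_def]) auto
    also have "(0 * z - 1 * 1) / (z * z)
        - (x * (\<alpha> * ((1 - \<alpha>) * A / (1 - z))) * B - x * (\<alpha> * A) * (\<alpha> * A)) / (B * B) = ?d"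
      using assms p unfolding e(1,2) A_def[symmetric] B_def[symmetric]
      by (simp add: divide_simps power2_eq_square) (simp add: algebra_simps)
    finally show ?thesis .
  qed
  have "(deriv (h \<alpha> x) has_real_derivative ?d) (at z)"
  proof (rule has_field_derivative_transform_within_open[OF d, where S = "{0<..<1}"])
    show "1 / y - x * (\<alpha> * (1 - y) powr (\<alpha> - 1)) / (1 - (1 - y) powr \<alpha>) = deriv (h \<alpha> x) y"
      if "y \<in> {0<..<1}" for y
      using DERIV_imp_deriv[OF h_has_real_derivative[OF assms(1) that]] by simp
  qed (use assms in auto)
  then show ?thesis by (rule DERIV_imp_deriv)
qed

section \<open>Asymptotics as the parameter tends to zero\<close>

text \<open>
  The critical equation reads \<open>w powr (1 - \<alpha>) * s = \<alpha> x\<close> with a chord slope \<open>s > \<alpha>\<close>.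
\<close>

lemma z_crit_bound:
  assumes "0 < \<alpha>" "\<alpha> < 1" "0 < x" "x < 1"
  shows "1 - z_crit \<alpha> x < x powr (1 / (1 - \<alpha>))"
proof -
  define w where "w = 1 - z_crit \<alpha> x"
  have w: "0 < w" "w < 1" using z_crit_root[OF assms] by (auto simp: w_def)
  have "w powr (1 - \<alpha>) * \<alpha> < w powr (1 - \<alpha>) * chord_slope \<alpha> w"
    using chord_slope_greater[OF assms(1,2) w] w by (intro mult_strict_left_mono) auto
  also have "\<dots> = x * \<alpha>"
    using crit_param_z_crit[OF assms] assms by (simp add: w_def[symmetric] crit_param_def field_simps)
  finally have "w powr (1 - \<alpha>) < x" using assms by simp
  then have "(w powr (1 - \<alpha>)) powr (1 / (1 - \<alpha>)) < x powr (1 / (1 - \<alpha>))"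
    using assms by (intro powr_less_mono2) auto
  then show ?thesis using w assms by (simp add: powr_powr w_def)
qed

lemma filterlim_one_minus_z_crit:
  assumes "0 < \<alpha>" "\<alpha> < 1"
  shows "filterlim (\<lambda>x. 1 - z_crit \<alpha> x) (at_right 0) (at_right 0)"
proof -
  have ev: "\<forall>\<^sub>F x in at_right 0. (x::real) \<in> {0<..<1}"
    by (rule eventually_at_right_real) simp
  have "((\<lambda>x. 1 - z_crit \<alpha> x) \<longlongrightarrow> 0) (at_right 0)"
  proof (rule tendsto_sandwich[OF _ _ tendsto_const])
    show "\<forall>\<^sub>F x in at_right 0. 0 \<le> 1 - z_crit \<alpha> x"
      using ev by eventually_elim (use z_crit_root[OF assms] in fastforce)
    show "\<forall>\<^sub>F x in at_right 0. 1 - z_crit \<alpha> x \<le> x powr (1 / (1 - \<alpha>))"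
      using ev by eventually_elim (use z_crit_bound[OF assms] in fastforce)
    show "((\<lambda>x::real. x powr (1 / (1 - \<alpha>))) \<longlongrightarrow> 0) (at_right 0)"
      using assms by real_asymp
  qed
  moreover have "\<forall>\<^sub>F x in at_right 0. 1 - z_crit \<alpha> x \<in> {0<..}"
    using ev by eventually_elim (use z_crit_root[OF assms] in fastforce)
  ultimately show ?thesis by (auto simp: filterlim_at elim: eventually_mono)
qed

text \<open>
  The principle that reduces the error estimates in \<open>x\<close> to expansions in \<open>w = 1 - z_crit \<alpha> x\<close>: by the bound
  above, \<open>w powr \<alpha>\<close> is at most \<open>x powr (\<alpha> / (1 - \<alpha>))\<close>.
\<close>

lemma bigo_at_z_crit:
  fixes F :: "real \<Rightarrow> real" and G :: "real \<Rightarrow> real"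
  assumes "0 < \<alpha>" "\<alpha> < 1"
  assumes F: "F \<in> O[at_right 0](\<lambda>w. w powr \<alpha>)"
  assumes FG: "\<And>x. 0 < x \<Longrightarrow> x < 1 \<Longrightarrow> F (1 - z_crit \<alpha> x) = G x"
  shows "G \<in> O[at_right 0](\<lambda>x. x powr (\<alpha> / (1 - \<alpha>)))"
proof -
  have ev: "\<forall>\<^sub>F x in at_right 0. (x::real) \<in> {0<..<1}"
    by (rule eventually_at_right_real) simp
  have "(\<lambda>x. F (1 - z_crit \<alpha> x)) \<in> O[at_right 0](\<lambda>x. (1 - z_crit \<alpha> x) powr \<alpha>)"
    using landau_o.big.compose[OF F filterlim_one_minus_z_crit[OF assms(1,2)]] .
  also have "(\<lambda>x. (1 - z_crit \<alpha> x) powr \<alpha>) \<in> O[at_right 0](\<lambda>x. x powr (\<alpha> / (1 - \<alpha>)))"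
  proof (rule landau_o.big_mono)
    show "\<forall>\<^sub>F x in at_right 0. norm ((1 - z_crit \<alpha> x) powr \<alpha>) \<le> norm (x powr (\<alpha> / (1 - \<alpha>)))"
      using ev
    proof eventually_elim
      case (elim x)
      have "(1 - z_crit \<alpha> x) powr \<alpha> \<le> (x powr (1 / (1 - \<alpha>))) powr \<alpha>"
        using z_crit_bound[of \<alpha> x] z_crit_root[of \<alpha> x] elim assms
        by (intro powr_mono2) auto
      then show ?case by (simp add: powr_powr)
    qed
  qed
  finally show ?thesis
    by (rule landau_o.big.in_cong[THEN iffD1, rotated])
       (use ev in eventually_elim, use FG in auto)
qed

text \<open>
  The leading-order expression \<open>(\<alpha> x) powr (1 / (1 - \<alpha>))\<close> is \<open>w\<close> times a power of the
  chord slope, which tends to \<open>1\<close> as \<open>w \<rightarrow> 0\<close>.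
\<close>

lemma rescaled_crit_param:
  assumes "0 < \<alpha>" "\<alpha> < 1" "0 < w" "w < 1"
  shows "\<alpha> powr (1 / (1 - \<alpha>)) * crit_param \<alpha> w powr (1 / (1 - \<alpha>))
     = w * chord_slope \<alpha> w powr (1 / (1 - \<alpha>))"
proof -
  have "chord_slope \<alpha> w > 0" using chord_slope_greater[OF assms] assms by simp
  then show ?thesis
    using assms by (simp add: crit_param_def powr_mult powr_divide powr_powr)
qed

lemma one_minus_z_crit_asymptotics:
  assumes "0 < \<alpha>" "\<alpha> < 1"
  shows "(\<lambda>x. (1 - z_crit \<alpha> x) / (\<alpha> powr (1 / (1 - \<alpha>)) * x powr (1 / (1 - \<alpha>))) - 1)
    \<in> O[at_right 0](\<lambda>x. x powr (\<alpha> / (1 - \<alpha>)))"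
proof (rule bigo_at_z_crit[OF assms])
  show "(\<lambda>w. 1 / chord_slope \<alpha> w powr (1 / (1 - \<alpha>)) - 1) \<in> O[at_right 0](\<lambda>w. w powr \<alpha>)"
    unfolding chord_slope_def using assms by real_asymp
next
  fix x :: real assume x: "0 < x" "x < 1"
  define w where "w = 1 - z_crit \<alpha> x"
  have w: "0 < w" "w < 1" and "crit_param \<alpha> w = x"
    using z_crit_root[OF assms x] crit_param_z_crit[OF assms x] by (auto simp: w_def)
  then have "\<alpha> powr (1 / (1 - \<alpha>)) * x powr (1 / (1 - \<alpha>)) = w * chord_slope \<alpha> w powr (1 / (1 - \<alpha>))"
    using rescaled_crit_param[OF assms w] by simp
  then show "1 / chord_slope \<alpha> (1 - z_crit \<alpha> x) powr (1 / (1 - \<alpha>)) - 1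
      = (1 - z_crit \<alpha> x) / (\<alpha> powr (1 / (1 - \<alpha>)) * x powr (1 / (1 - \<alpha>))) - 1"
    using w by (simp add: w_def[symmetric])
qed

text \<open>
  Substituting the critical parameter removes \<open>x\<close>. The second factor on the right is \<open>1 + O(w powr \<alpha>)\<close>,
  so the leading term is \<open>- (1 - \<alpha>) / w\<close>.
\<close>

lemma deriv_deriv_h_crit_param:
  assumes "0 < \<alpha>" "\<alpha> < 1" "0 < w" "w < 1"
  shows "deriv (deriv (h \<alpha> (crit_param \<alpha> w))) (1 - w) = - ((1 - \<alpha>) / w) *
    (1 / (1 - w) + w / ((1 - \<alpha>) * (1 - w)\<^sup>2)
      - \<alpha> * w powr \<alpha> / ((1 - \<alpha>) * (1 - w) * (1 - w powr \<alpha>)))"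
proof -
  define a where "a = w powr \<alpha>"
  have a: "0 < a" "a < 1"
    using assms one_minus_powr_pos[of \<alpha> "1 - w"] by (auto simp: a_def)
  have p: "w powr (\<alpha> - 2) = a / w\<^sup>2" "w powr (2 * \<alpha> - 2) = a\<^sup>2 / w\<^sup>2" "w powr (1 - \<alpha>) = w / a"
    using assms by (simp_all add: a_def powr_diff power2_eq_square powr_add[symmetric])
  have "deriv (deriv (h \<alpha> (crit_param \<alpha> w))) (1 - w) =
    - (1 / (1 - w)\<^sup>2) - (w / a * (1 - a) / (1 - w)) *
      ((1 - \<alpha>) * (a / w\<^sup>2) / (1 - a) - \<alpha> * (a\<^sup>2 / w\<^sup>2) / (1 - a)\<^sup>2)"
    using assms deriv_deriv_h[of \<alpha> "1 - w"]
    by (simp add: crit_param_def chord_slope_def p a_def[symmetric])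
  also have "\<dots> = - ((1 - \<alpha>) / w) * (1 / (1 - w) + w / ((1 - \<alpha>) * (1 - w)\<^sup>2)
      - \<alpha> * a / ((1 - \<alpha>) * (1 - w) * (1 - a)))"
    using assms a by (simp add: divide_simps power2_eq_square) (simp add: algebra_simps)
  finally show ?thesis by (simp add: a_def)
qed

lemma deriv_deriv_h_asymptotics:
  assumes "0 < \<alpha>" "\<alpha> < 1"
  shows "(\<lambda>x. deriv (deriv (h \<alpha> x)) (z_crit \<alpha> x)
      / (- ((1 - \<alpha>) / \<alpha> powr (1 / (1 - \<alpha>))) * (1 / x powr (1 / (1 - \<alpha>)))) - 1)
    \<in> O[at_right 0](\<lambda>x. x powr (\<alpha> / (1 - \<alpha>)))"
proof (rule bigo_at_z_crit[OF assms])
  define E where "E w = 1 / (1 - w) + w / ((1 - \<alpha>) * (1 - w)\<^sup>2)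
      - \<alpha> * w powr \<alpha> / ((1 - \<alpha>) * (1 - w) * (1 - w powr \<alpha>))" for w
  show "(\<lambda>w. E w * chord_slope \<alpha> w powr (1 / (1 - \<alpha>)) - 1) \<in> O[at_right 0](\<lambda>w. w powr \<alpha>)"
    unfolding chord_slope_def E_def using assms by real_asymp
  fix x :: real assume x: "0 < x" "x < 1"
  define w where "w = 1 - z_crit \<alpha> x"
  have w: "0 < w" "w < 1" and cw: "crit_param \<alpha> w = x"
    using z_crit_root[OF assms x] crit_param_z_crit[OF assms x] by (auto simp: w_def)
  have q: "\<alpha> powr (1 / (1 - \<alpha>)) * x powr (1 / (1 - \<alpha>)) = w * chord_slope \<alpha> w powr (1 / (1 - \<alpha>))"
    using rescaled_crit_param[OF assms w] cw by simp
  have "deriv (deriv (h \<alpha> x)) (z_crit \<alpha> x) = - ((1 - \<alpha>) / w) * E w"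
    using deriv_deriv_h_crit_param[OF assms w] cw by (simp add: w_def E_def)
  then have "deriv (deriv (h \<alpha> x)) (z_crit \<alpha> x)
      / (- ((1 - \<alpha>) / \<alpha> powr (1 / (1 - \<alpha>))) * (1 / x powr (1 / (1 - \<alpha>))))
     = E w / w * (\<alpha> powr (1 / (1 - \<alpha>)) * x powr (1 / (1 - \<alpha>)))"
    using assms x w by simp
  then show "E (1 - z_crit \<alpha> x) * chord_slope \<alpha> (1 - z_crit \<alpha> x) powr (1 / (1 - \<alpha>)) - 1
      = deriv (deriv (h \<alpha> x)) (z_crit \<alpha> x)
        / (- ((1 - \<alpha>) / \<alpha> powr (1 / (1 - \<alpha>))) * (1 / x powr (1 / (1 - \<alpha>)))) - 1"
    unfolding q using w by (simp add: w_def[symmetric])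
qed

text \<open>
  The singular factor \<open>w powr (\<alpha> - 1)\<close> of \<open>I''\<close> meets a factor \<open>w powr \<alpha>\<close> from \<open>z'\<close>; what is left
  besides \<open>w powr (2 * \<alpha> - 1)\<close> depends on \<open>w\<close> only through the chord slope and so has a limit.
\<close>

lemma deriv_deriv_I_crit_eq:
  assumes "0 < \<alpha>" "\<alpha> < 1" "0 < x" "x < 1"
  defines "w \<equiv> 1 - z_crit \<alpha> x"
  shows "deriv (deriv (I_crit \<alpha>)) x
    = \<alpha>\<^sup>2 * w powr (2 * \<alpha> - 1) / (chord_slope \<alpha> w * (chord_slope \<alpha> w - \<alpha>))"
proof -
  have w: "0 < w" "w < 1" using z_crit_root[OF assms(1-4)] by (auto simp: w_def)
  have s: "\<alpha> < chord_slope \<alpha> w" using chord_slope_greater[OF assms(1,2) w] .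
  have "deriv (deriv (I_crit \<alpha>)) x
      = \<alpha> * w powr (\<alpha> - 1) / (1 - w powr \<alpha>) * inverse (crit_param_deriv \<alpha> w)"
    using DERIV_imp_deriv[OF has_real_derivative_deriv_I_crit[OF assms(1-4)]]
      DERIV_imp_deriv[OF has_real_derivative_z_crit[OF assms(1-4)]]
    by (simp add: w_def)
  also have "1 - w powr \<alpha> = chord_slope \<alpha> w * (1 - w)"
    using w by (simp add: chord_slope_def)
  also have "\<alpha> * w powr (\<alpha> - 1) / (chord_slope \<alpha> w * (1 - w)) * inverse (crit_param_deriv \<alpha> w)
      = \<alpha>\<^sup>2 * (w powr (\<alpha> - 1) * w powr \<alpha>) / (chord_slope \<alpha> w * (chord_slope \<alpha> w - \<alpha>))"
    using w s assms(1,2) unfolding crit_param_deriv_def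
    by (simp add: powr_minus divide_simps power2_eq_square)
  also have "w powr (\<alpha> - 1) * w powr \<alpha> = w powr (2 * \<alpha> - 1)"
    by (simp add: powr_add[symmetric])
  finally show ?thesis .
qed

lemma deriv_deriv_I_crit_asymptotics:
  assumes "0 < \<alpha>" "\<alpha> < 1"
  shows "deriv (deriv (I_crit \<alpha>)) \<sim>[at_right 0]
    (\<lambda>x. \<alpha> powr (1 / (1 - \<alpha>)) / (1 - \<alpha>) * x powr ((2 * \<alpha> - 1) / (1 - \<alpha>)))"
proof (rule asymp_equivI')
  define e where "e = (2 * \<alpha> - 1) / (1 - \<alpha>)"
  define s where "s x = chord_slope \<alpha> (1 - z_crit \<alpha> x)" for x
  have "(chord_slope \<alpha> \<longlongrightarrow> 1) (at_right 0)"
    unfolding chord_slope_def[abs_def] using assms by real_asymp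
  then have s_lim: "(s \<longlongrightarrow> 1) (at_right 0)"
    unfolding s_def by (rule filterlim_compose[OF _ filterlim_one_minus_z_crit[OF assms]])
  \<comment> \<open>The quotient of the two sides: the powers of \<open>w\<close> cancel because \<open>(1 - \<alpha>) e = 2 \<alpha> - 1\<close>.\<close>
  have "((\<lambda>x. (1 - \<alpha>) / (s x * (s x - \<alpha>) * s x powr e)) \<longlongrightarrow> (1 - \<alpha>) / (1 * (1 - \<alpha>) * 1 powr e)) (at_right 0)"
    using assms by (intro tendsto_intros s_lim) auto
  then have lim: "((\<lambda>x. (1 - \<alpha>) / (s x * (s x - \<alpha>) * s x powr e)) \<longlongrightarrow> 1) (at_right 0)"
    using assms by simp
  have "\<forall>\<^sub>F x in at_right 0. (x::real) \<in> {0<..<1}"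
    by (rule eventually_at_right_real) simp
  then have "\<forall>\<^sub>F x in at_right 0. (1 - \<alpha>) / (s x * (s x - \<alpha>) * s x powr e)
    = deriv (deriv (I_crit \<alpha>)) x / (\<alpha> powr (1 / (1 - \<alpha>)) / (1 - \<alpha>) * x powr e)"
  proof eventually_elim
    case (elim x)
    define w where "w = 1 - z_crit \<alpha> x"
    have x: "0 < x" "x < 1" using elim by auto
    have w: "0 < w" "w < 1" and cw: "crit_param \<alpha> w = x"
      using z_crit_root[OF assms x] crit_param_z_crit[OF assms x] by (auto simp: w_def)
    have sw: "s x = chord_slope \<alpha> w" by (simp add: s_def w_def)
    have s: "\<alpha> < s x" unfolding sw using chord_slope_greater[OF assms w] .
    have xs: "x = w powr (1 - \<alpha>) * s x / \<alpha>" using cw by (simp add: crit_param_def sw)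
    have "(1 - \<alpha>) * e = 2 * \<alpha> - 1" using assms by (simp add: e_def)
    then have "(w powr (1 - \<alpha>) * s x / \<alpha>) powr e = w powr (2 * \<alpha> - 1) * s x powr e / \<alpha> powr e"
      using s assms w by (simp add: powr_mult powr_divide powr_powr)
    then have x_e: "x powr e = w powr (2 * \<alpha> - 1) * s x powr e / \<alpha> powr e"
      unfolding xs[symmetric] .
    have \<alpha>_e: "\<alpha> powr (1 / (1 - \<alpha>)) = \<alpha>\<^sup>2 * \<alpha> powr e"
    proof -
      have "1 / (1 - \<alpha>) = 2 + e" using assms by (simp add: e_def field_simps)
      then show ?thesis using assms by (simp add: powr_add)
    qed
    have I_e: "deriv (deriv (I_crit \<alpha>)) x
        = \<alpha>\<^sup>2 * w powr (2 * \<alpha> - 1) / (s x * (s x - \<alpha>))"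
      using deriv_deriv_I_crit_eq[OF assms x] by (simp add: w_def s_def)
    show ?case unfolding x_e \<alpha>_e I_e using s w assms by simp
  qed
  with lim show "((\<lambda>x. deriv (deriv (I_crit \<alpha>)) x
      / (\<alpha> powr (1 / (1 - \<alpha>)) / (1 - \<alpha>) * x powr ((2 * \<alpha> - 1) / (1 - \<alpha>)))) \<longlongrightarrow> 1) (at_right 0)"
    unfolding e_def[symmetric] by (rule Lim_transform_eventually)
qed

theorem lemma3p4:
  fixes \<alpha> :: real
  assumes "0 < \<alpha>" and "\<alpha> < 1"
  shows "(\<forall>x\<in>{0<..<1}.
           (I_crit \<alpha> has_real_derivative - ln (1 - (1 - z_crit \<alpha> x) powr \<alpha>)) (at x)) \<and>
         (\<forall>x\<in>{0<..<1}.
           z_crit \<alpha> differentiable (at x) \<and>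
           (deriv (I_crit \<alpha>) has_real_derivative
             - (\<alpha> * (1 - z_crit \<alpha> x) powr (\<alpha> - 1) / (1 - (1 - z_crit \<alpha> x) powr \<alpha>))
               * deriv (z_crit \<alpha>) x) (at x)) \<and>
         ((\<lambda>x. (1 - z_crit \<alpha> x) / (\<alpha> powr (1 / (1 - \<alpha>)) * x powr (1 / (1 - \<alpha>))) - 1)
           \<in> O[at_right 0](\<lambda>x. x powr (\<alpha> / (1 - \<alpha>)))) \<and>
         (deriv (deriv (I_crit \<alpha>)) \<sim>[at_right 0]
           (\<lambda>x. \<alpha> powr (1 / (1 - \<alpha>)) / (1 - \<alpha>) * x powr ((2 * \<alpha> - 1) / (1 - \<alpha>)))) \<and>
         ((\<lambda>x. deriv (deriv (h \<alpha> x)) (z_crit \<alpha> x)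
                / (- ((1 - \<alpha>) / \<alpha> powr (1 / (1 - \<alpha>))) * (1 / x powr (1 / (1 - \<alpha>)))) - 1)
           \<in> O[at_right 0](\<lambda>x. x powr (\<alpha> / (1 - \<alpha>))))"
  using has_real_derivative_I_crit[OF assms] has_real_derivative_deriv_I_crit[OF assms]
    z_crit_differentiable[OF assms]
    one_minus_z_crit_asymptotics[OF assms] deriv_deriv_I_crit_asymptotics[OF assms]
    deriv_deriv_h_asymptotics[OF assms]
  by (simp only: greaterThanLessThan_iff Ball_def) blast

end
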